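(* Let $\mathbb{P}$ be an $r$-rectangular uncertainty set whose factor sets $\mathcal{W}^1,\dots,\mathcal{W}^r$ satisfy the tractability assumption stated in the context. Then there exists a stationary and deterministic policy that is a solution of the policy improvement problem $$\max_{\pi\in\Pi^G}\min_{P\in\mathbb{P}}R(\pi,P).$$
   Context: MDP setting: finite state set $\mathcal{S}$, $|\mathcal{S}|=S$; finite action set $\mathcal{A}$, $|\mathcal{A}|=A$; rewards $r_{sa}\ge0$; discount factor $\lambda\in(0,1)$; initial probability distribution $p_0$ on $\mathcal{S}$. $\Pi^G$ is the set of all policies: for each period $t$ a policy maps histories $(s_0,a_0,\dots,s_t)$ to probability distributions on $\mathcal{A}$. A policy is stationary if this distribution depends only on the current state (not on $t$ or the past), so it is given by $(\pi_{sa})$; it is deterministic if all $\pi_{sa}\in\{0,1\}$. For a transition kernel $P$, $R(\pi,P)=\mathbb{E}^{\pi,P}\big[\sum_{t\ge0}\lambda^t r_{s_ta_t}\mid s_0\sim p_0\big]$. $r$-rectangular uncertainty set: fix an integer $r\ge1$, coefficients $u^i_{sa}\ge0$ with $\sum_{i=1}^r u^i_{sa}=1$ for all $(s,a)$, and sets $\mathcal{W}^1,\dots,\mathcal{W}^r$ of probability vectors in $\mathbb{R}^S_+$; put $\mathcal{W}=\mathcal{W}^1\times\dots\times\mathcal{W}^r$. Each $W=(w_1,\dots,w_r)\in\mathcal{W}$ determines the kernel $P_{sas'}=\sum_{i=1}^r u^i_{sa}w_{i,s'}$, and $\mathbb{P}$ is the set of all these kernels. Tractability assumption: the $\mathcal{W}^i$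 are (nonempty) convex compact and, for any $i$ and any cost vector $c\in\mathbb{R}^S$, an $\epsilon$-optimal solution of $\min_{w_i\in\mathcal{W}^i}c^\top w_i$ can be found in $O(comp(\mathcal{W}^i)\log(\epsilon^{-1}))$ arithmetic operations, where $comp(\mathcal{W}^i)\in\mathbb{R}$ depends only on the structure of $\mathcal{W}^i$. *)

theory Defs
  imports "HOL-Probability.Probability" "HOL-Library.Landau_Symbols"
begin

text \<open>
  A policy maps the past state-action pairs \<open>(s\<^sub>0, a\<^sub>0), \<dots>, (s\<^sub>t\<^sub>-\<^sub>1, a\<^sub>t\<^sub>-\<^sub>1)\<close> and the current state
  \<open>s\<^sub>t\<close> to a distribution on actions. The period \<open>t\<close> is the length of the list, so this type is
  the set of all (history-dependent, randomized) policies.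
\<close>
type_synonym ('s, 'a) policy = "('s \<times> 'a) list \<Rightarrow> 's \<Rightarrow> 'a pmf"

definition stationary :: "('s, 'a) policy \<Rightarrow> bool" where
  "stationary \<pi> \<longleftrightarrow> (\<exists>d. \<forall>h s. \<pi> h s = d s)"

definition deterministic :: "('s, 'a) policy \<Rightarrow> bool" where
  "deterministic \<pi> \<longleftrightarrow> (\<forall>h s a. pmf (\<pi> h s) a \<in> {0, 1})"

type_synonym ('s, 'a) kernel = "'s \<Rightarrow> 'a \<Rightarrow> real ^ 's"

definition prob_vector :: "real ^ 's::finite \<Rightarrow> bool" where
  "prob_vector w \<longleftrightarrow> (\<forall>s. 0 \<le> w $ s) \<and> (\<Sum>s\<in>UNIV. w $ s) = 1"

text \<open>The value is meaningful only if \<open>P s a\<close> is a probability vector.\<close>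
definition kernel_pmf :: "('s::finite, 'a) kernel \<Rightarrow> 's \<Rightarrow> 'a \<Rightarrow> 's pmf" where
  "kernel_pmf P s a = embed_pmf (\<lambda>s'. P s a $ s')"

text \<open>The conditional law of \<open>(s\<^sub>n, a\<^sub>n)\<close> given \<open>\<omega> 0, \<dots>, \<omega> (n - 1)\<close>.\<close>
definition step_pmf ::
  "'s pmf \<Rightarrow> ('s::finite, 'a) policy \<Rightarrow> ('s, 'a) kernel \<Rightarrow> nat \<Rightarrow> (nat \<Rightarrow> 's \<times> 'a) \<Rightarrow> ('s \<times> 'a) pmf" where
  "step_pmf p0 \<pi> P n \<omega> =
     bind_pmf (case n of 0 \<Rightarrow> p0 | Suc m \<Rightarrow> kernel_pmf P (fst (\<omega> m)) (snd (\<omega> m)))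
       (\<lambda>s. map_pmf (\<lambda>a. (s, a)) (\<pi> (map \<omega> [0..<n]) s))"

lemma Ionescu_Tulcea_step_pmf:
  fixes p0 :: "'s::finite pmf" and \<pi> :: "('s, 'a::finite) policy"
  shows "Ionescu_Tulcea (\<lambda>n \<omega>. measure_pmf (step_pmf p0 \<pi> P n \<omega>)) (\<lambda>_. count_space UNIV)"
proof
  fix i :: nat
  have "PiM {0..<i} (\<lambda>_. count_space (UNIV :: ('s \<times> 'a) set))
      = count_space (PiE {0..<i} (\<lambda>_. UNIV))"
    by (rule count_space_PiM_finite) auto
  then show "(\<lambda>\<omega>. measure_pmf (step_pmf p0 \<pi> P i \<omega>))
      \<in> measurable (PiM {0..<i} (\<lambda>_. count_space UNIV)) (subprob_algebra (count_space UNIV))"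
    by (simp add: measurable_count_space_eq1 space_subprob_algebra
        measure_pmf.subprob_space_axioms)
qed

text \<open>
  The law of the trajectory \<open>(s\<^sub>t, a\<^sub>t)\<^sub>t\<close> on the infinite product space, by the Ionescu-Tulcea theorem.
\<close>
definition trajectory_measure ::
  "'s pmf \<Rightarrow> ('s::finite, 'a::finite) policy \<Rightarrow> ('s, 'a) kernel \<Rightarrow> (nat \<Rightarrow> 's \<times> 'a) measure" where
  "trajectory_measure p0 \<pi> P =
     projective_family.lim UNIV
       (Ionescu_Tulcea.CI (\<lambda>n \<omega>. measure_pmf (step_pmf p0 \<pi> P n \<omega>)) (\<lambda>_. count_space UNIV))
       (\<lambda>_. count_space UNIV)"

definition reward ::
  "'s pmf \<Rightarrow> ('s::finite \<Rightarrow> 'a::finite \<Rightarrow> real) \<Rightarrow> real \<Rightarrow> ('s, 'a) policy \<Rightarrow> ('s, 'a) kernel \<Rightarrow> real" where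
  "reward p0 rew \<gamma> \<pi> P =
     (\<integral>\<omega>. (\<Sum>t. \<gamma> ^ t * rew (fst (\<omega> t)) (snd (\<omega> t))) \<partial>trajectory_measure p0 \<pi> P)"


definition r_rectangular ::
  "nat \<Rightarrow> (nat \<Rightarrow> 's::finite \<Rightarrow> 'a \<Rightarrow> real) \<Rightarrow> (nat \<Rightarrow> (real ^ 's) set) \<Rightarrow> ('s, 'a) kernel set" where
  "r_rectangular r u \<W> =
     {(\<lambda>s a. \<Sum>i=1..r. u i s a *\<^sub>R w i) | w. \<forall>i\<in>{1..r}. w i \<in> \<W> i}"

text \<open>
  \<open>\<pi>\<close> solves \<open>max\<^sub>\<pi> min\<^sub>P R(\<pi>, P)\<close>. The first conjunct says that the inner minima exist, so that the
  infima in the second one are minima.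
\<close>
definition solves_policy_improvement ::
  "'s pmf \<Rightarrow> ('s::finite \<Rightarrow> 'a::finite \<Rightarrow> real) \<Rightarrow> real \<Rightarrow> ('s, 'a) kernel set \<Rightarrow> ('s, 'a) policy \<Rightarrow> bool" where
  "solves_policy_improvement p0 rew \<gamma> \<P> \<pi> \<longleftrightarrow>
     (\<forall>\<pi>'. \<exists>P\<in>\<P>. \<forall>Q\<in>\<P>. reward p0 rew \<gamma> \<pi>' P \<le> reward p0 rew \<gamma> \<pi>' Q) \<and>
     (\<forall>\<pi>'. (INF P\<in>\<P>. reward p0 rew \<gamma> \<pi>' P) \<le> (INF P\<in>\<P>. reward p0 rew \<gamma> \<pi> P))"


text \<open>
  Arithmetic operations are counted on a real RAM: registers hold reals, addressed directly or
  through natural-number index registers. Program constants are arbitrary reals, every executed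
  instruction costs 1, and the machine halts when the program counter leaves the program.
\<close>
datatype address = Direct nat | Indirect nat

datatype instruction =
    Const address real
  | Move address address
  | Add address address address
  | Sub address address address
  | Mul address address address
  | Div address address address
  | JumpLe address address nat
  | IdxConst nat nat
  | IdxMove nat nat
  | IdxInc nat
  | IdxDec nat
  | IdxJumpLe nat nat nat

record machine =
  pc :: nat
  mem :: "nat \<Rightarrow> real"
  idx :: "nat \<Rightarrow> nat"

fun loc :: "machine \<Rightarrow> address \<Rightarrow> nat" where
  "loc \<sigma> (Direct k) = k"
| "loc \<sigma> (Indirect k) = idx \<sigma> k"

definition val :: "machine \<Rightarrow> address \<Rightarrow> real" where
  "val \<sigma> x = mem \<sigma> (loc \<sigma> x)"

definition put :: "machine \<Rightarrow> address \<Rightarrow> real \<Rightarrow> machine" where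
  "put \<sigma> x v = \<sigma>\<lparr>pc := Suc (pc \<sigma>), mem := (mem \<sigma>)(loc \<sigma> x := v)\<rparr>"

definition put_idx :: "machine \<Rightarrow> nat \<Rightarrow> nat \<Rightarrow> machine" where
  "put_idx \<sigma> k v = \<sigma>\<lparr>pc := Suc (pc \<sigma>), idx := (idx \<sigma>)(k := v)\<rparr>"

definition jump_if :: "machine \<Rightarrow> bool \<Rightarrow> nat \<Rightarrow> machine" where
  "jump_if \<sigma> b l = \<sigma>\<lparr>pc := (if b then l else Suc (pc \<sigma>))\<rparr>"

fun exec :: "instruction \<Rightarrow> machine \<Rightarrow> machine" where
  "exec (Const z c) \<sigma> = put \<sigma> z c"
| "exec (Move z x) \<sigma> = put \<sigma> z (val \<sigma> x)"
| "exec (Add z x y) \<sigma> = put \<sigma> z (val \<sigma> x + val \<sigma> y)"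
| "exec (Sub z x y) \<sigma> = put \<sigma> z (val \<sigma> x - val \<sigma> y)"
| "exec (Mul z x y) \<sigma> = put \<sigma> z (val \<sigma> x * val \<sigma> y)"
| "exec (Div z x y) \<sigma> = put \<sigma> z (val \<sigma> x / val \<sigma> y)"
| "exec (JumpLe x y l) \<sigma> = jump_if \<sigma> (val \<sigma> x \<le> val \<sigma> y) l"
| "exec (IdxConst k n) \<sigma> = put_idx \<sigma> k n"
| "exec (IdxMove k j) \<sigma> = put_idx \<sigma> k (idx \<sigma> j)"
| "exec (IdxInc k) \<sigma> = put_idx \<sigma> k (Suc (idx \<sigma> k))"
| "exec (IdxDec k) \<sigma> = put_idx \<sigma> k (idx \<sigma> k - 1)"
| "exec (IdxJumpLe k j l) \<sigma> = jump_if \<sigma> (idx \<sigma> k \<le> idx \<sigma> j) l"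

definition halted :: "instruction list \<Rightarrow> machine \<Rightarrow> bool" where
  "halted prog \<sigma> \<longleftrightarrow> length prog \<le> pc \<sigma>"

definition machine_step :: "instruction list \<Rightarrow> machine \<Rightarrow> machine" where
  "machine_step prog \<sigma> = (if halted prog \<sigma> then \<sigma> else exec (prog ! pc \<sigma>) \<sigma>)"

text \<open>
  Input, for an enumeration \<open>e\<close> of the states: \<open>c $ s\<close> in register \<open>e s\<close> and \<open>\<epsilon>\<close> in the next free
  register. The output vector is read from the registers \<open>e s\<close>.
\<close>
definition initial_machine :: "('s::finite \<Rightarrow> nat) \<Rightarrow> real ^ 's \<Rightarrow> real \<Rightarrow> machine" where
  "initial_machine e c \<epsilon> =
     \<lparr>pc = 0,
      mem = (\<lambda>k. if k < CARD('s) then c $ (THE s. e s = k) else if k = CARD('s) then \<epsilon> else 0),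
      idx = (\<lambda>_. 0)\<rparr>"

definition eps_optimal :: "(real ^ 's::finite) set \<Rightarrow> real ^ 's \<Rightarrow> real \<Rightarrow> real ^ 's \<Rightarrow> bool" where
  "eps_optimal W c \<epsilon> w \<longleftrightarrow> w \<in> W \<and> (\<forall>w'\<in>W. c \<bullet> w \<le> c \<bullet> w' + \<epsilon>)"

text \<open>
  One program serves all costs \<open>c\<close> and tolerances \<open>\<epsilon>\<close>. \<open>T c \<epsilon>\<close> bounds its number of operations; for
  each \<open>c\<close> it is \<open>O(\<kappa> log (1/\<epsilon>))\<close> as \<open>\<epsilon> \<rightarrow> 0\<close>, where \<open>\<kappa>\<close> does not depend on \<open>c\<close>.
\<close>
definition linear_min_in_time :: "(real ^ 's::finite) set \<Rightarrow> real \<Rightarrow> bool" where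
  "linear_min_in_time W \<kappa> \<longleftrightarrow>
     (\<exists>prog (e :: 's \<Rightarrow> nat) (T :: real ^ 's \<Rightarrow> real \<Rightarrow> nat).
        bij_betw e UNIV {..<CARD('s)} \<and>
        (\<forall>c \<epsilon>. 0 < \<epsilon> \<longrightarrow>
           (let \<sigma> = (machine_step prog ^^ T c \<epsilon>) (initial_machine e c \<epsilon>)
            in halted prog \<sigma> \<and> eps_optimal W c \<epsilon> (\<chi> s. mem \<sigma> (e s)))) \<and>
        (\<forall>c. (\<lambda>\<epsilon>. real (T c \<epsilon>)) \<in> O[at_right 0](\<lambda>\<epsilon>. \<kappa> * ln (1 / \<epsilon>))))"

text \<open>\<open>complexity\<close> assigns a complexity to a set, hence depends on nothing else.\<close>
definition tractable :: "((real ^ 's::finite) set \<Rightarrow> real) \<Rightarrow> (real ^ 's) set \<Rightarrow> bool" where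
  "tractable complexity W \<longleftrightarrow>
     W \<noteq> {} \<and> convex W \<and> compact W \<and> linear_min_in_time W (complexity W)"

end

(* The game has a saddle point. The robust Bellman operator
     F v s = max_a (rew s a + gamma * sum_i u_i(s,a) * min_{w in W_i} w . v)
   is monotone and maps a box into itself, so it has a fixpoint v. The minimiser of w . v
   over W_i does not depend on (s, a), so the minimisers give a single kernel of the
   uncertainty set, and v is a supersolution of the ordinary Bellman equation for it:
   no policy earns more than p0 . v against this kernel. Conversely, v is a subsolution for the
   greedy stationary policy under every kernel of the set, so this policy guarantees p0 . v.
   The inner minima are attained for every policy because the reward is a uniform limit of finite
   horizon rewards, which are continuous in the factors w_i ranging over a compact product. *)
theory Submission
  imports Defs
begin

subsection \<open>Integration along trajectories\<close>

text \<open>These three facts are all that is used later about the projective limit. The law of a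
  prefix is the finite composition \<open>C 0 n\<close> because \<open>CI\<close> on an initial
  segment involves no projection: the cylinder over a set of full prefixes is that set
  itself.\<close>

lemma
  fixes \<pi> :: "('s::finite, 'a::finite) policy"
  shows prob_space_trajectory: "prob_space (trajectory_measure p0 \<pi> P)"
    and sets_trajectory [measurable_cong]:
      "sets (trajectory_measure p0 \<pi> P) = sets (PiM UNIV (\<lambda>_. count_space UNIV))"
    and distr_trajectory:
      "distr (trajectory_measure p0 \<pi> P) (PiM {0..<n} (\<lambda>_. count_space UNIV)) (\<lambda>\<omega>. restrict \<omega> {0..<n})
       = Ionescu_Tulcea.C (\<lambda>n \<omega>. measure_pmf (step_pmf p0 \<pi> P n \<omega>)) (\<lambda>_. count_space UNIV) 0 n (\<lambda>_. undefined)"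
proof -
  interpret IT: Ionescu_Tulcea "\<lambda>n \<omega>. measure_pmf (step_pmf p0 \<pi> P n \<omega>)"
      "\<lambda>_. count_space (UNIV :: ('s \<times> 'a) set)"
    by (rule Ionescu_Tulcea_step_pmf)
  have T: "trajectory_measure p0 \<pi> P = IT.PF.lim"
    by (simp add: trajectory_measure_def)
  show S: "sets (trajectory_measure p0 \<pi> P) = sets (PiM UNIV (\<lambda>_. count_space UNIV))"
    unfolding T by (rule IT.PF.sets_lim)
  have C: "IT.CI {0..<n} = IT.C 0 n (\<lambda>_. undefined)" for n
  proof (rule measure_eqI)
    show "sets (IT.CI {0..<n}) = sets (IT.C 0 n (\<lambda>_. undefined))"
      by (simp add: IT.CI_def IT.sets_C)
    fix X assume "X \<in> sets (IT.CI {0..<n})"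
    then have X: "X \<in> sets (PiM {0..<n} (\<lambda>_. count_space UNIV))"
      by (simp add: IT.CI_def)
    then show "emeasure (IT.CI {0..<n}) X = emeasure (IT.C 0 n (\<lambda>_. undefined)) X"
      using sets.sets_into_space[OF X]
      by (subst IT.emeasure_CI[of _ n]) (auto simp: prod_emb_id space_PiM)
  qed
  show D: "distr (trajectory_measure p0 \<pi> P) (PiM {0..<n} (\<lambda>_. count_space UNIV)) (\<lambda>\<omega>. restrict \<omega> {0..<n})
       = IT.C 0 n (\<lambda>_. undefined)" for n
    unfolding T C[symmetric] by (rule IT.distr_lim) simp
  \<comment> \<open>Total mass is preserved by image measures, so it can be read off the law of the
    empty prefix.\<close>
  have "prob_space (distr (trajectory_measure p0 \<pi> P) (PiM {0..<0} (\<lambda>_. count_space UNIV)) (\<lambda>\<omega>. restrict \<omega> {0..<0}))"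
    unfolding D by (rule IT.prob_space_C) simp
  then show "prob_space (trajectory_measure p0 \<pi> P)"
    by (rule prob_space_distrD[rotated])
      (auto intro!: measurable_restrict simp: measurable_cong_sets[OF S refl])
qed

section \<open>Functions of finitely many coordinates\<close>

lemma PiM_discrete:
  "PiM {0..<n::nat} (\<lambda>_. count_space (UNIV :: 'b::finite set)) = count_space (PiE {0..<n} (\<lambda>_. UNIV))"
  by (rule count_space_PiM_finite) auto

lemma measurable_prefix [measurable]:
  fixes f :: "(nat \<Rightarrow> 's::finite \<times> 'a::finite) \<Rightarrow> real"
  shows "(\<lambda>\<omega>. f (restrict \<omega> {0..<n})) \<in> borel_measurable (trajectory_measure p0 \<pi> P)"
proof -
  have "(\<lambda>\<omega>. restrict \<omega> {0..<n}) \<in> measurable (trajectory_measure p0 \<pi> P)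
          (PiM {0..<n} (\<lambda>_. count_space UNIV))"
    by (auto intro!: measurable_restrict simp: measurable_cong_sets[OF sets_trajectory refl])
  moreover have "f \<in> borel_measurable (PiM {0..<n} (\<lambda>_. count_space UNIV))"
    by (simp add: PiM_discrete)
  ultimately show ?thesis by (rule measurable_compose)
qed

lemma integrable_prefix:
  fixes f :: "(nat \<Rightarrow> 's::finite \<times> 'a::finite) \<Rightarrow> real"
  shows "integrable (trajectory_measure p0 \<pi> P) (\<lambda>\<omega>. f (restrict \<omega> {0..<n}))"
proof -
  interpret prob_space "trajectory_measure p0 \<pi> P" by (rule prob_space_trajectory)
  let ?K = "PiE {0..<n} (\<lambda>_. UNIV) :: (nat \<Rightarrow> 's \<times> 'a) set"
  have "norm (f (restrict \<omega> {0..<n})) \<le> Max ((\<lambda>h. norm (f h)) ` ?K)" for \<omega>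
    by (rule Max_ge) (auto simp: finite_PiE)
  then show ?thesis
    by (intro integrable_const_bound[where B="Max ((\<lambda>h. norm (f h)) ` ?K)"]) auto
qed

text \<open>Conditioning on the first \<open>n\<close> coordinates: \<open>C 0 (Suc n)\<close> is
  \<open>C 0 n\<close> composed with the step kernel \<open>eP n\<close>, and the inner integral is
  a finite sum. All later links between the trajectory law and \<open>step_pmf\<close> go through
  this identity.\<close>

lemma integral_trajectory_Suc:
  fixes f :: "(nat \<Rightarrow> 's::finite \<times> 'a::finite) \<Rightarrow> real"
  shows "(\<integral>\<omega>. f (restrict \<omega> {0..<Suc n}) \<partial>trajectory_measure p0 \<pi> P) =
    (\<integral>\<omega>. (\<Sum>x\<in>UNIV. pmf (step_pmf p0 \<pi> P n (restrict \<omega> {0..<n})) x * f ((restrict \<omega> {0..<n})(n := x)))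
        \<partial>trajectory_measure p0 \<pi> P)"
proof -
  let ?T = "trajectory_measure p0 \<pi> P"
  let ?M = "\<lambda>n::nat. PiM {0..<n} (\<lambda>_. count_space (UNIV :: ('s \<times> 'a) set))"
  interpret IT: Ionescu_Tulcea "\<lambda>n \<omega>. measure_pmf (step_pmf p0 \<pi> P n \<omega>)"
      "\<lambda>_. count_space (UNIV :: ('s \<times> 'a) set)"
    by (rule Ionescu_Tulcea_step_pmf)
  \<comment> \<open>Stated for every \<open>n\<close>, since it serves both horizon
    \<open>Suc n\<close> and horizon \<open>n\<close>.\<close>
  have I: "(\<integral>\<omega>. g (restrict \<omega> {0..<n}) \<partial>?T) = (\<integral>\<omega>. g \<omega> \<partial>IT.C 0 n (\<lambda>_. undefined))"
    for g :: "(nat \<Rightarrow> 's \<times> 'a) \<Rightarrow> real" and n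
    unfolding distr_trajectory[symmetric]
  proof (rule integral_distr[symmetric])
    show "(\<lambda>\<omega>. restrict \<omega> {0..<n}) \<in> measurable ?T (?M n)"
      by (auto intro!: measurable_restrict simp: measurable_cong_sets[OF sets_trajectory refl])
  qed (simp add: PiM_discrete)
  have sp: "space (IT.C 0 n (\<lambda>_. undefined)) = space (?M n)" for n
    using IT.space_C[of "\<lambda>_. undefined" 0 n] by simp
  have prob: "prob_space (IT.C 0 n (\<lambda>_. undefined))"
    using IT.prob_space_C[of "\<lambda>_. undefined" 0 n] by simp
  let ?K = "PiE {0..<Suc n} (\<lambda>_. UNIV) :: (nat \<Rightarrow> 's \<times> 'a) set"
  have "(\<integral>\<omega>. f \<omega> \<partial>IT.C 0 (Suc n) (\<lambda>_. undefined)) =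
      (\<integral>\<omega>. (\<integral>x. f x \<partial>IT.eP n \<omega>) \<partial>IT.C 0 n (\<lambda>_. undefined))"
    unfolding IT.C.simps add_0
  proof (rule integral_bind)
    show "f \<in> borel_measurable (?M (Suc n))" by (simp add: PiM_discrete)
    show "\<bar>f x\<bar> \<le> Max ((\<lambda>h. \<bar>f h\<bar>) ` ?K)" if "x \<in> space (?M (Suc n))" for x
      using that by (intro Max_ge) (auto simp: finite_PiE PiM_discrete)
    show "IT.eP n \<in> measurable (IT.C 0 n (\<lambda>_. undefined)) (subprob_algebra (?M (Suc n)))"
      using IT.measurable_eP[of n] IT.sets_C[of "\<lambda>_. undefined" 0 n]
      by (simp cong: measurable_cong_sets)
    show "finite_measure (IT.C 0 n (\<lambda>_. undefined))"
      using prob by (rule prob_space.finite_measure)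
    show "AE \<omega> in IT.C 0 n (\<lambda>_. undefined). emeasure (IT.eP n \<omega>) (space (IT.eP n \<omega>)) \<le> ennreal 1"
      using prob_space.emeasure_space_1[OF IT.prob_space_eP] by (intro AE_I2) (simp add: sp)
  qed
  also have "\<dots> = (\<integral>h. (\<Sum>x\<in>UNIV. pmf (step_pmf p0 \<pi> P n h) x * f (h(n := x)))
      \<partial>IT.C 0 n (\<lambda>_. undefined))"
  proof (rule Bochner_Integration.integral_cong[OF refl])
    fix h assume "h \<in> space (IT.C 0 n (\<lambda>_. undefined))"
    then have h: "h \<in> PiE {0..<n} (\<lambda>_. UNIV)" by (simp add: sp PiM_discrete)
    have "(\<integral>x. f x \<partial>IT.eP n h) = (\<integral>x. f (h(n := x)) \<partial>step_pmf p0 \<pi> P n h)"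
      unfolding IT.eP_def
    proof (rule integral_distr)
      \<comment> \<open>The prefix \<open>h\<close> is \<open>undefined\<close> outside
        \<open>{0..<n}\<close>, so the update at \<open>n\<close> is again an extensional prefix, of
        length \<open>Suc n\<close>.\<close>
      show "fun_upd h n \<in> measurable (measure_pmf (step_pmf p0 \<pi> P n h)) (?M (Suc n))"
        using h by (auto simp: PiM_discrete PiE_iff extensional_def)
    qed (simp add: PiM_discrete)
    then show "(\<integral>x. f x \<partial>IT.eP n h) =
        (\<Sum>x\<in>UNIV. pmf (step_pmf p0 \<pi> P n h) x * f (h(n := x)))"
      by (simp add: integral_measure_pmf[where A=UNIV])
  qed
  finally show ?thesis
    unfolding I[symmetric] .
qed

lemma step_pmf_restrict: "step_pmf p0 \<pi> P n (restrict \<omega> {0..<n}) = step_pmf p0 \<pi> P n \<omega>"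
proof -
  have "map (restrict \<omega> {0..<n}) [0..<n] = map \<omega> [0..<n]" by simp
  then show ?thesis unfolding step_pmf_def by (cases n) (simp_all del: map_eq_conv upt_Suc)
qed

section \<open>Expectations at a single time\<close>

lemma integral_coordinate:
  fixes f :: "'s::finite \<times> 'a::finite \<Rightarrow> real"
  shows "(\<integral>\<omega>. f (\<omega> n) \<partial>trajectory_measure p0 \<pi> P) =
    (\<integral>\<omega>. (\<Sum>x\<in>UNIV. pmf (step_pmf p0 \<pi> P n \<omega>) x * f x) \<partial>trajectory_measure p0 \<pi> P)"
  using integral_trajectory_Suc[where f = "\<lambda>\<omega>. f (\<omega> n)" and n = n] by (simp add: step_pmf_restrict)

lemma integrable_coordinate:
  fixes f :: "'s::finite \<times> 'a::finite \<Rightarrow> real"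
  shows "integrable (trajectory_measure p0 \<pi> P) (\<lambda>\<omega>. f (\<omega> n))"
  using integrable_prefix[of p0 \<pi> P "\<lambda>\<omega>. f (\<omega> n)" "Suc n"] by simp

lemma abs_integral_coordinate_le:
  fixes f :: "'s::finite \<times> 'a::finite \<Rightarrow> real"
  assumes "\<And>x. \<bar>f x\<bar> \<le> B"
  shows "\<bar>\<integral>\<omega>. f (\<omega> n) \<partial>trajectory_measure p0 \<pi> P\<bar> \<le> B"
proof -
  interpret prob_space "trajectory_measure p0 \<pi> P" by (rule prob_space_trajectory)
  have "\<bar>\<integral>\<omega>. f (\<omega> n) \<partial>trajectory_measure p0 \<pi> P\<bar>
      \<le> (\<integral>\<omega>. \<bar>f (\<omega> n)\<bar> \<partial>trajectory_measure p0 \<pi> P)"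
    by (rule integral_abs_bound)
  also have "\<dots> \<le> B"
    by (rule integral_le_const)
      (use assms integrable_coordinate[of p0 \<pi> P "\<lambda>x. \<bar>f x\<bar>" n] in auto)
  finally show ?thesis .
qed

text \<open>Pairs outside the support of the step law carry weight zero. Asking for the sign only on
  actions that the policy may choose is what later allows a greedy policy, whose Bellman inequality
  is known for its own action only.\<close>

lemma integral_coordinate_nonneg:
  fixes f :: "'s::finite \<times> 'a::finite \<Rightarrow> real"
  assumes "\<And>h s a. a \<in> set_pmf (\<pi> h s) \<Longrightarrow> 0 \<le> f (s, a)"
  shows "0 \<le> (\<integral>\<omega>. f (\<omega> n) \<partial>trajectory_measure p0 \<pi> P)"
proof -
  have "0 \<le> pmf (step_pmf p0 \<pi> P n \<omega>) x * f x" for \<omega> x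
  proof (cases "x \<in> set_pmf (step_pmf p0 \<pi> P n \<omega>)")
    case True
    then have "0 \<le> f x" using assms by (auto simp: step_pmf_def)
    then show ?thesis by simp
  qed (simp add: set_pmf_iff)
  then show ?thesis
    unfolding integral_coordinate by (intro Bochner_Integration.integral_nonneg sum_nonneg) auto
qed

text \<open>The state is drawn before the action, so projecting to the state eliminates the
  policy.\<close>

lemma sum_step_pmf_state:
  fixes v :: "'s::finite \<Rightarrow> real" and \<pi> :: "('s, 'a::finite) policy"
  shows "(\<Sum>x\<in>UNIV. pmf (step_pmf p0 \<pi> P n \<omega>) x * v (fst x)) =
    (\<Sum>s\<in>UNIV. pmf (case n of 0 \<Rightarrow> p0 | Suc m \<Rightarrow> kernel_pmf P (fst (\<omega> m)) (snd (\<omega> m))) s * v s)"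
proof -
  have "(\<Sum>x\<in>UNIV. pmf (step_pmf p0 \<pi> P n \<omega>) x * v (fst x)) =
      (\<integral>s. v s \<partial>map_pmf fst (step_pmf p0 \<pi> P n \<omega>))"
    by (simp add: integral_measure_pmf[where A=UNIV])
  also have "map_pmf fst (step_pmf p0 \<pi> P n \<omega>) =
      (case n of 0 \<Rightarrow> p0 | Suc m \<Rightarrow> kernel_pmf P (fst (\<omega> m)) (snd (\<omega> m)))"
    by (simp add: step_pmf_def map_bind_pmf map_pmf_comp map_pmf_const bind_return_pmf')
  finally show ?thesis by (simp add: integral_measure_pmf[where A=UNIV])
qed

lemma pmf_kernel_pmf:
  assumes "prob_vector (P s a)"
  shows "pmf (kernel_pmf P s a) s' = P s a $ s'"
  unfolding kernel_pmf_def
proof (rule pmf_embed_pmf)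
  show "(\<integral>\<^sup>+x. ennreal (P s a $ x) \<partial>count_space UNIV) = 1"
    using assms by (simp add: prob_vector_def nn_integral_count_space_finite sum_ennreal)
qed (use assms in \<open>auto simp: prob_vector_def\<close>)

subsection \<open>Discounted rewards\<close>

text \<open>Expectation and series may be exchanged because a bound \<open>B\<close> on the finitely
  many rewards yields the summable majorant \<open>\<gamma> ^ t * B\<close>.\<close>

lemma reward_sums:
  fixes rew :: "'s::finite \<Rightarrow> 'a::finite \<Rightarrow> real"
  assumes "0 \<le> \<gamma>" "\<gamma> < 1"
  shows "(\<lambda>t. \<gamma> ^ t * (\<integral>\<omega>. rew (fst (\<omega> t)) (snd (\<omega> t)) \<partial>trajectory_measure p0 \<pi> P)) sums reward p0 rew \<gamma> \<pi> P"
proof -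
  interpret prob_space "trajectory_measure p0 \<pi> P" by (rule prob_space_trajectory)
  define B where "B = Max (range (\<lambda>x. \<bar>rew (fst x) (snd x)\<bar>))"
  have B: "\<bar>rew s a\<bar> \<le> B" for s a
    unfolding B_def by (rule Max_ge) (auto intro!: image_eqI[of _ _ "(s, a)"])
  have le: "norm (\<gamma> ^ t * rew s a) \<le> \<gamma> ^ t * B" for t s a
    using B[of s a] assms by (simp add: abs_mult mult_left_mono)
  have int: "integrable (trajectory_measure p0 \<pi> P) (\<lambda>\<omega>. \<gamma> ^ t * rew (fst (\<omega> t)) (snd (\<omega> t)))" for t
    by (rule integrable_coordinate[of p0 \<pi> P "\<lambda>x. \<gamma> ^ t * rew (fst x) (snd x)"])
  have summ: "summable (\<lambda>t. \<gamma> ^ t * B)"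
    using assms by (intro summable_mult2 summable_geometric) auto
  have "(\<lambda>t. \<integral>\<omega>. \<gamma> ^ t * rew (fst (\<omega> t)) (snd (\<omega> t)) \<partial>trajectory_measure p0 \<pi> P) sums reward p0 rew \<gamma> \<pi> P"
    unfolding reward_def
  proof (rule sums_integral)
    show "AE \<omega> in trajectory_measure p0 \<pi> P. summable (\<lambda>t. norm (\<gamma> ^ t * rew (fst (\<omega> t)) (snd (\<omega> t))))"
      using le by (intro AE_I2 summable_comparison_test'[OF summ]) auto
    have "(\<integral>\<omega>. norm (\<gamma> ^ t * rew (fst (\<omega> t)) (snd (\<omega> t))) \<partial>trajectory_measure p0 \<pi> P) \<le> \<gamma> ^ t * B" for t
      by (rule integral_le_const) (use int le in auto)
    then show "summable (\<lambda>t. \<integral>\<omega>. norm (\<gamma> ^ t * rew (fst (\<omega> t)) (snd (\<omega> t))) \<partial>trajectory_measure p0 \<pi> P)"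
      by (intro summable_comparison_test'[OF summ]) auto
  qed (rule int)
  then show ?thesis by simp
qed

lemma reward_uminus:
  fixes rew :: "'s::finite \<Rightarrow> 'a::finite \<Rightarrow> real"
  assumes "0 \<le> \<gamma>" "\<gamma> < 1"
  shows "reward p0 (\<lambda>s a. - rew s a) \<gamma> \<pi> P = - reward p0 rew \<gamma> \<pi> P"
  using reward_sums[OF assms, where rew = "\<lambda>s a. - rew s a"] sums_minus[OF reward_sums[OF assms, where rew = rew]]
  by simp (rule sums_unique2)

text \<open>Integrating the Bellman inequality at time \<open>t\<close> relates the expected values
  of \<open>v\<close> at times \<open>t\<close> and \<open>Suc t\<close>. Iteration gives the
  discounted reward up to a horizon \<open>n\<close> plus a remainder
  \<open>\<gamma> ^ n * V n\<close>, which vanishes since \<open>v\<close> is bounded. The policy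
  may depend on the history.\<close>

lemma reward_ge_subsolution:
  fixes rew :: "'s::finite \<Rightarrow> 'a::finite \<Rightarrow> real"
  assumes \<gamma>: "0 \<le> \<gamma>" "\<gamma> < 1"
    and P: "\<And>s a. prob_vector (P s a)"
    and v: "\<And>h s a. a \<in> set_pmf (\<pi> h s) \<Longrightarrow> v s \<le> rew s a + \<gamma> * (\<Sum>s'\<in>UNIV. P s a $ s' * v s')"
  shows "(\<Sum>s\<in>UNIV. pmf p0 s * v s) \<le> reward p0 rew \<gamma> \<pi> P"
proof -
  let ?T = "trajectory_measure p0 \<pi> P"
  interpret prob_space ?T by (rule prob_space_trajectory)
  define R where "R t = (\<integral>\<omega>. rew (fst (\<omega> t)) (snd (\<omega> t)) \<partial>?T)" for t
  define V where "V t = (\<integral>\<omega>. v (fst (\<omega> t)) \<partial>?T)" for t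
  note int = integrable_coordinate[where \<pi>=\<pi> and P=P]
  have V0: "V 0 = (\<Sum>s\<in>UNIV. pmf p0 s * v s)"
    unfolding V_def using integral_coordinate[of p0 \<pi> P "\<lambda>x. v (fst x)" 0]
    by (simp add: sum_step_pmf_state prob_space)
  \<comment> \<open>Given the pair at time \<open>t\<close>, the next state follows the kernel row
    at that pair, so the expectation moves back to time \<open>t\<close>.\<close>
  have VSuc: "V (Suc t) = (\<integral>\<omega>. (\<Sum>s\<in>UNIV. P (fst (\<omega> t)) (snd (\<omega> t)) $ s * v s) \<partial>?T)" for t
    unfolding V_def using integral_coordinate[of p0 \<pi> P "\<lambda>x. v (fst x)" "Suc t"]
    by (simp add: sum_step_pmf_state pmf_kernel_pmf P)
  have step: "V t \<le> R t + \<gamma> * V (Suc t)" for t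
  proof -
    have "0 \<le> (\<integral>\<omega>. (rew (fst (\<omega> t)) (snd (\<omega> t)) +
        \<gamma> * (\<Sum>s\<in>UNIV. P (fst (\<omega> t)) (snd (\<omega> t)) $ s * v s)) - v (fst (\<omega> t)) \<partial>?T)"
      by (rule integral_coordinate_nonneg[of \<pi> "\<lambda>x. (rew (fst x) (snd x) +
        \<gamma> * (\<Sum>s\<in>UNIV. P (fst x) (snd x) $ s * v s)) - v (fst x)"]) (use v in auto)
    also have "\<dots> = R t + \<gamma> * V (Suc t) - V t"
      unfolding VSuc R_def V_def[of t]
      using int[of p0 "\<lambda>x. rew (fst x) (snd x)" t] int[of p0 "\<lambda>x. v (fst x)" t]
        int[of p0 "\<lambda>x. \<Sum>s\<in>UNIV. P (fst x) (snd x) $ s * v s" t]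
      by (simp del: integral_sum)
    finally show ?thesis by simp
  qed
  have mono: "V 0 \<le> (\<Sum>t<n. \<gamma> ^ t * R t) + \<gamma> ^ n * V n" for n
  proof (induction n)
    case (Suc n)
    have "\<gamma> ^ n * V n \<le> \<gamma> ^ n * (R n + \<gamma> * V (Suc n))"
      using \<gamma> by (intro mult_left_mono step) auto
    with Suc show ?case by (simp add: algebra_simps)
  qed simp
  define K where "K = Max (range (\<lambda>s. \<bar>v s\<bar>))"
  have bounded: "\<bar>V n\<bar> \<le> K" for n
    unfolding V_def
    by (rule abs_integral_coordinate_le[of "\<lambda>x. v (fst x)"]) (auto simp: K_def intro: Max_ge)
  have "(\<lambda>n. \<gamma> ^ n * V n) \<longlonglongrightarrow> 0"
  proof (rule lim_null_mult_right_bounded)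
    show "(\<lambda>n. \<gamma> ^ n) \<longlonglongrightarrow> 0" using \<gamma> by (intro LIMSEQ_power_zero) simp
    show "\<forall>\<^sub>F n in sequentially. norm (V n) \<le> K" using bounded by simp
  qed
  moreover have "(\<lambda>n. \<Sum>t<n. \<gamma> ^ t * R t) \<longlonglongrightarrow> reward p0 rew \<gamma> \<pi> P"
    using reward_sums[OF \<gamma>, where rew = rew] by (simp add: sums_def R_def)
  ultimately have "(\<lambda>n. (\<Sum>t<n. \<gamma> ^ t * R t) + \<gamma> ^ n * V n) \<longlonglongrightarrow> reward p0 rew \<gamma> \<pi> P + 0"
    by (intro tendsto_add)
  then show ?thesis
    unfolding V0[symmetric] by (intro LIMSEQ_le_const) (use mono in auto)
qed

text \<open>The subsolution bound applied to \<open>- rew\<close> and \<open>- v\<close>. The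
  inequality is required at every action because \<open>\<pi>\<close> is arbitrary.\<close>

lemma reward_le_supersolution:
  fixes rew :: "'s::finite \<Rightarrow> 'a::finite \<Rightarrow> real"
  assumes "0 \<le> \<gamma>" "\<gamma> < 1" "\<And>s a. prob_vector (P s a)"
    and "\<And>s a. rew s a + \<gamma> * (\<Sum>s'\<in>UNIV. P s a $ s' * v s') \<le> v s"
  shows "reward p0 rew \<gamma> \<pi> P \<le> (\<Sum>s\<in>UNIV. pmf p0 s * v s)"
proof -
  have "(\<Sum>s\<in>UNIV. pmf p0 s * - v s) \<le> reward p0 (\<lambda>s a. - rew s a) \<gamma> \<pi> P"
  proof (rule reward_ge_subsolution[OF assms(1-3)])
    show "- v s \<le> - rew s a + \<gamma> * (\<Sum>s'\<in>UNIV. P s a $ s' * - v s')" for s a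
      using assms(4)[of s a] by (simp add: sum_negf)
  qed
  then show ?thesis using assms by (simp add: reward_uminus sum_negf)
qed

subsection \<open>Continuity in the kernel\<close>

text \<open>Induction that integrates out the last coordinate. The step probabilities become part of
  the integrand, which is why \<open>f\<close> has to depend on \<open>z\<close>.\<close>

lemma continuous_on_integral_prefix:
  fixes f :: "'b::topological_space \<Rightarrow> (nat \<Rightarrow> 's::finite \<times> 'a::finite) \<Rightarrow> real"
    and P :: "'b \<Rightarrow> ('s, 'a) kernel"
  assumes P: "\<And>z s a. z \<in> Z \<Longrightarrow> prob_vector (P z s a)"
    and cont: "\<And>s a. continuous_on Z (\<lambda>z. P z s a)"
    and f: "\<And>\<omega>. continuous_on Z (\<lambda>z. f z \<omega>)"
  shows "continuous_on Z (\<lambda>z. \<integral>\<omega>. f z (restrict \<omega> {0..<n}) \<partial>trajectory_measure p0 \<pi> (P z))"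
  using f
proof (induction n arbitrary: f)
  case 0
  then show ?case
    by (simp add: prob_space.prob_space[OF prob_space_trajectory])
next
  case (Suc n)
  \<comment> \<open>\<open>kernel_pmf\<close> returns the kernel entry only at probability vectors,
    so continuity is transferred from the entries on \<open>Z\<close>.\<close>
  have "continuous_on Z (\<lambda>z. pmf (kernel_pmf (P z) s a) s')" for s a s'
  proof -
    have "continuous_on Z (\<lambda>z. P z s a $ s')" by (intro continuous_intros cont)
    then show ?thesis by (rule continuous_on_eq) (simp add: pmf_kernel_pmf P)
  qed
  then have "continuous_on Z (\<lambda>z. pmf (step_pmf p0 \<pi> (P z) n \<omega>) x)" for \<omega> x
    by (cases n) (auto simp: step_pmf_def pmf_bind integral_measure_pmf[where A=UNIV] intro!: continuous_intros)
  then have "continuous_on Z (\<lambda>z. \<Sum>x\<in>UNIV. pmf (step_pmf p0 \<pi> (P z) n h) x * f z (h(n := x)))" for h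
    by (intro continuous_intros Suc.prems)
  from Suc.IH[OF this] show ?case
    unfolding integral_trajectory_Suc .
qed

lemma continuous_on_reward:
  fixes rew :: "'s::finite \<Rightarrow> 'a::finite \<Rightarrow> real" and P :: "'b::topological_space \<Rightarrow> ('s, 'a) kernel"
  assumes \<gamma>: "0 \<le> \<gamma>" "\<gamma> < 1"
    and P: "\<And>z s a. z \<in> Z \<Longrightarrow> prob_vector (P z s a)"
    and cont: "\<And>s a. continuous_on Z (\<lambda>z. P z s a)"
  shows "continuous_on Z (\<lambda>z. reward p0 rew \<gamma> \<pi> (P z))"
proof -
  define R where "R t z = (\<integral>\<omega>. rew (fst (\<omega> t)) (snd (\<omega> t)) \<partial>trajectory_measure p0 \<pi> (P z))" for t z
  define B where "B = Max (range (\<lambda>x. \<bar>rew (fst x) (snd x)\<bar>))"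
  have B: "\<bar>rew s a\<bar> \<le> B" for s a
    unfolding B_def by (rule Max_ge) (auto intro!: image_eqI[of _ _ "(s, a)"])
  have R: "\<bar>R t z\<bar> \<le> B" for t z
    unfolding R_def
    by (rule abs_integral_coordinate_le[of "\<lambda>x. rew (fst x) (snd x)"]) (simp add: B)
  have contR: "continuous_on Z (R t)" for t
    using continuous_on_integral_prefix[OF P cont, where f = "\<lambda>z \<omega>. rew (fst (\<omega> t)) (snd (\<omega> t))" and n = "Suc t"]
    by (simp add: R_def[abs_def])
  have "uniform_limit Z (\<lambda>n z. \<Sum>t<n. \<gamma> ^ t * R t z) (\<lambda>z. \<Sum>t. \<gamma> ^ t * R t z) sequentially"
  proof (rule Weierstrass_m_test)
    show "norm (\<gamma> ^ t * R t z) \<le> \<gamma> ^ t * B" for t z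
      using R[of t z] \<gamma> by (simp add: abs_mult mult_left_mono)
    show "summable (\<lambda>t. \<gamma> ^ t * B)"
      using \<gamma> by (intro summable_mult2 summable_geometric) auto
  qed
  then have "continuous_on Z (\<lambda>z. \<Sum>t. \<gamma> ^ t * R t z)"
    by (rule uniform_limit_theorem[rotated]) (auto intro!: continuous_intros contR always_eventually)
  then show ?thesis
    by (simp add: R_def sums_unique[OF reward_sums[OF \<gamma>], symmetric])
qed

subsection \<open>The saddle point\<close>

text \<open>Knaster-Tarski on the functions with values between \<open>0\<close> and
  \<open>M\<close>: the pointwise supremum of all \<open>d\<close> with \<open>d \<le> F d\<close>
  is a fixpoint.\<close>

lemma mono_fixpoint_box:
  fixes F :: "('b \<Rightarrow> real) \<Rightarrow> 'b \<Rightarrow> real"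
  assumes mono: "\<And>v w. v \<le> w \<Longrightarrow> F v \<le> F w"
    and box: "\<And>s. 0 \<le> F (\<lambda>_. 0) s" "\<And>s. F (\<lambda>_. M) s \<le> M"
    and "0 \<le> M"
  obtains v where "F v = v"
proof -
  define D where "D = {v. (\<forall>s. 0 \<le> v s \<and> v s \<le> M) \<and> v \<le> F v}"
  define v where "v s = (SUP d\<in>D. d s)" for s
  have D0: "(\<lambda>_. 0) \<in> D" using box \<open>0 \<le> M\<close> by (auto simp: D_def le_fun_def)
  have bdd: "bdd_above ((\<lambda>d. d s) ` D)" for s
    by (rule bdd_aboveI[of _ M]) (auto simp: D_def)
  have up: "d \<le> v" if "d \<in> D" for d
    unfolding le_fun_def v_def using that by (auto intro!: cSUP_upper bdd)
  have le: "v s \<le> c" if "\<And>d. d \<in> D \<Longrightarrow> d s \<le> c" for s c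
    unfolding v_def using that D0 by (intro cSUP_least) auto
  have v: "0 \<le> v s" "v s \<le> M" for s
    using up[OF D0] le[of s M] by (auto simp: le_fun_def D_def)
  have "v s \<le> F v s" for s
  proof (rule le)
    fix d assume "d \<in> D"
    with mono[OF up[OF this]] show "d s \<le> F v s"
      by (auto simp: D_def le_fun_def intro: order_trans)
  qed
  then have 1: "v \<le> F v" by (simp add: le_fun_def)
  have "F (\<lambda>_. 0) \<le> F v" "F v \<le> F (\<lambda>_. M)"
    using v by (simp_all add: mono le_funI)
  then have "0 \<le> F v s" "F v s \<le> M" for s
    using box[of s] order_trans unfolding le_fun_def by blast+
  \<comment> \<open>\<open>F v \<le> F (F v)\<close> puts \<open>F v\<close> into \<open>D\<close>,
    whence \<open>F v \<le> v\<close>.\<close>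
  with mono[OF 1] have "F v \<in> D" by (auto simp: D_def)
  from up[OF this] 1 show ?thesis by (intro that[of v]) auto
qed

lemma prob_vector_mean:
  fixes w :: "'i \<Rightarrow> real ^ 's::finite"
  assumes "\<And>i. i \<in> I \<Longrightarrow> 0 \<le> c i" "(\<Sum>i\<in>I. c i) = 1" "\<And>i. i \<in> I \<Longrightarrow> prob_vector (w i)"
  shows "prob_vector (\<Sum>i\<in>I. c i *\<^sub>R w i)"
proof -
  have "(\<Sum>s\<in>UNIV. \<Sum>i\<in>I. c i * w i $ s) = (\<Sum>i\<in>I. c i * (\<Sum>s\<in>UNIV. w i $ s))"
    by (subst sum.swap) (simp add: sum_distrib_left)
  also have "\<dots> = 1" using assms by (simp add: prob_vector_def)
  finally show ?thesis
    using assms by (auto simp: prob_vector_def sum_component intro!: sum_nonneg)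
qed

theorem lemma4p1:
  fixes rew :: "'s::finite \<Rightarrow> 'a::finite \<Rightarrow> real"
    and \<gamma> :: real
    and p0 :: "'s pmf"
    and r :: nat
    and u :: "nat \<Rightarrow> 's \<Rightarrow> 'a \<Rightarrow> real"
    and \<W> :: "nat \<Rightarrow> (real ^ 's) set"
    and complexity :: "(real ^ 's) set \<Rightarrow> real"
  assumes "\<And>s a. 0 \<le> rew s a"
    and "0 < \<gamma>" and "\<gamma> < 1"
    and "1 \<le> r"
    and "\<And>i s a. i \<in> {1..r} \<Longrightarrow> 0 \<le> u i s a"
    and "\<And>s a. (\<Sum>i=1..r. u i s a) = 1"
    and "\<And>i w. i \<in> {1..r} \<Longrightarrow> w \<in> \<W> i \<Longrightarrow> prob_vector w"
    and "\<And>i. i \<in> {1..r} \<Longrightarrow> tractable complexity (\<W> i)"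
  shows "\<exists>\<pi> :: ('s, 'a) policy. stationary \<pi> \<and> deterministic \<pi> \<and>
           solves_policy_improvement p0 rew \<gamma> (r_rectangular r u \<W>) \<pi>"
proof -
  note rew = assms(1) and u_nonneg = assms(5) and u_sum = assms(6) and prob = assms(7)
  have \<gamma>: "0 \<le> \<gamma>" "\<gamma> < 1" using assms by auto
  have W: "\<W> i \<noteq> {}" "compact (\<W> i)" if "i \<in> {1..r}" for i
    using assms(8)[OF that] by (auto simp: tractable_def)
  define kern where "kern w = (\<lambda>s a. \<Sum>i=1..r. u i s a *\<^sub>R w i)" for w :: "nat \<Rightarrow> real ^ 's"
  \<comment> \<open>Indices outside \<open>{1..r}\<close> are pinned to \<open>0\<close>. They do
    not affect \<open>kern\<close>, and \<open>Z\<close> becomes a product of compact sets over all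
    of \<open>nat\<close>, compact by Tychonoff.\<close>
  define Z where "Z = PiE UNIV (\<lambda>i. if i \<in> {1..r} then \<W> i else {0})"
  have kern_prob: "prob_vector (kern w s a)" if "\<And>i. i \<in> {1..r} \<Longrightarrow> w i \<in> \<W> i" for w s a
    unfolding kern_def using that u_nonneg u_sum prob by (intro prob_vector_mean) auto
  have Z: "w i \<in> \<W> i" if "w \<in> Z" "i \<in> {1..r}" for w i
    using PiE_mem[OF that(1)[unfolded Z_def], of i] that(2) by simp
  have rect: "r_rectangular r u \<W> = kern ` Z"
  proof (intro subset_antisym subsetI)
    fix P assume "P \<in> r_rectangular r u \<W>"
    then obtain w where w: "P = kern w" "\<forall>i\<in>{1..r}. w i \<in> \<W> i"
      by (auto simp: r_rectangular_def kern_def)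
    let ?w = "\<lambda>i. if i \<in> {1..r} then w i else 0"
    have "P = kern ?w" unfolding w kern_def by (intro ext sum.cong) auto
    moreover have "?w \<in> Z" using w by (auto simp: Z_def)
    ultimately show "P \<in> kern ` Z" by blast
  next
    fix P assume "P \<in> kern ` Z"
    then show "P \<in> r_rectangular r u \<W>"
      using Z unfolding r_rectangular_def kern_def by blast
  qed
  have compactZ: "compact Z"
    using W by (auto simp: Z_def compactin_PiE euclidean_product_topology[symmetric]
        simp flip: compactin_euclidean_iff)
  have Z_ne: "Z \<noteq> {}" using W by (auto simp: Z_def PiE_eq_empty_iff)

  have attained: "\<exists>P\<in>kern ` Z. \<forall>Q\<in>kern ` Z. reward p0 rew \<gamma> \<pi> P \<le> reward p0 rew \<gamma> \<pi> Q" for \<pi>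
  proof -
    have "continuous_on Z (\<lambda>w. reward p0 rew \<gamma> \<pi> (kern w))"
    proof (rule continuous_on_reward[OF \<gamma>])
      show "continuous_on Z (\<lambda>w. kern w s a)" for s a
        unfolding kern_def
        by (intro continuous_intros continuous_on_subset[OF continuous_on_product_coordinates]) auto
    qed (use kern_prob Z in auto)
    from continuous_attains_inf[OF compactZ Z_ne this] show ?thesis by auto
  qed

  \<comment> \<open>Worst-case factors for a given value function\<close>
  define m where "m i v = (INF w\<in>\<W> i. \<Sum>s\<in>UNIV. w $ s * v s)" for i and v :: "'s \<Rightarrow> real"
  have min_ex: "\<exists>w\<in>\<W> i. (\<Sum>s\<in>UNIV. w $ s * v s) = m i v \<and>
      (\<forall>w'\<in>\<W> i. m i v \<le> (\<Sum>s\<in>UNIV. w' $ s * v s))" if "i \<in> {1..r}" for i v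
  proof -
    have "continuous_on (\<W> i) (\<lambda>w. \<Sum>s\<in>UNIV. w $ s * v s)" by (intro continuous_intros)
    from continuous_attains_inf[OF W(2)[OF that] W(1)[OF that] this]
    obtain w where w: "w \<in> \<W> i" "\<And>w'. w' \<in> \<W> i \<Longrightarrow> (\<Sum>s\<in>UNIV. w $ s * v s) \<le> (\<Sum>s\<in>UNIV. w' $ s * v s)"
      by blast
    then have "m i v = (\<Sum>s\<in>UNIV. w $ s * v s)"
      unfolding m_def by (intro cInf_eq_minimum) auto
    with w show ?thesis by auto
  qed
  \<comment> \<open>One minimiser per factor, chosen before any state or action is seen; hence
    \<open>kern (wmin v)\<close> is a member of the uncertainty set.\<close>
  define wmin where "wmin v i = (SOME w. w \<in> \<W> i \<and> (\<Sum>s\<in>UNIV. w $ s * v s) = m i v)" for v i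
  have wmin: "wmin v i \<in> \<W> i" "(\<Sum>s\<in>UNIV. wmin v i $ s * v s) = m i v" if "i \<in> {1..r}" for v i
    using someI_ex[of "\<lambda>w. w \<in> \<W> i \<and> (\<Sum>s\<in>UNIV. w $ s * v s) = m i v"] min_ex[OF that, of v]
    by (auto simp: wmin_def)
  have m_le: "m i v \<le> (\<Sum>s\<in>UNIV. w $ s * v s)" if "i \<in> {1..r}" "w \<in> \<W> i" for i w v
    using min_ex[OF that(1), of v] that by blast
  have m_mono: "m i v \<le> m i v'" if "i \<in> {1..r}" "v \<le> v'" for i v v'
  proof -
    have "m i v \<le> (\<Sum>s\<in>UNIV. wmin v' i $ s * v s)"
      using that wmin by (intro m_le) auto
    also have "\<dots> \<le> (\<Sum>s\<in>UNIV. wmin v' i $ s * v' s)"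
      using that prob[OF that(1) wmin(1)[OF that(1)], of v']
      by (intro sum_mono mult_left_mono) (auto simp: prob_vector_def le_fun_def)
    finally show ?thesis using wmin that by simp
  qed
  have m_const: "m i (\<lambda>_. c) = c" if "i \<in> {1..r}" for i c
    using wmin(2)[OF that, of "\<lambda>_. c"] prob[OF that wmin(1)[OF that], of "\<lambda>_. c"]
    by (simp add: prob_vector_def flip: sum_distrib_right)

  \<comment> \<open>The robust Bellman operator and its fixpoint\<close>
  define G where "G v s a = rew s a + \<gamma> * (\<Sum>i=1..r. u i s a * m i v)" for v s a
  define F where "F v s = Max (range (G v s))" for v s
  have G_le: "G v s a \<le> F v s" for v s a unfolding F_def by (rule Max_ge) auto
  have F_le: "F v s \<le> c" if "\<And>a. G v s a \<le> c" for v s c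
    unfolding F_def using that by (subst Max_le_iff) auto
  have G_const: "G (\<lambda>_. c) s a = rew s a + \<gamma> * c" for c s a
    using u_sum[of s a] by (simp add: G_def m_const flip: sum_distrib_right)
  define B where "B = Max (range (\<lambda>x. rew (fst x) (snd x)))"
  have B: "rew s a \<le> B" for s a
    unfolding B_def by (rule Max_ge) (auto intro!: image_eqI[of _ _ "(s, a)"])
  have "0 \<le> B" using B rew order_trans by blast
  obtain v where v: "F v = v"
  \<comment> \<open>\<open>B / (1 - \<gamma>)\<close> is the solution of
    \<open>M = B + \<gamma> * M\<close>, the value of earning \<open>B\<close> forever.\<close>
  proof (rule mono_fixpoint_box[of F "B / (1 - \<gamma>)"])
    show "F v \<le> F v'" if "v \<le> v'" for v v'
      unfolding le_fun_def
    proof (intro allI F_le)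
      fix s a
      have "G v s a \<le> G v' s a"
        unfolding G_def using u_nonneg m_mono that \<gamma>
        by (intro add_left_mono mult_left_mono sum_mono) auto
      then show "G v s a \<le> F v' s" using G_le order_trans by blast
    qed
    show "0 \<le> F (\<lambda>_. 0) s" for s
      \<comment> \<open>\<open>undefined\<close> stands for an arbitrary action.\<close>
      using G_le[of "\<lambda>_. 0" s undefined] rew[of s undefined] by (simp add: G_const)
    show "F (\<lambda>_. B / (1 - \<gamma>)) s \<le> B / (1 - \<gamma>)" for s
    proof (rule F_le)
      fix a
      have "B + \<gamma> * (B / (1 - \<gamma>)) = B / (1 - \<gamma>)" using \<gamma> by (simp add: field_simps)
      with B[of s a] show "G (\<lambda>_. B / (1 - \<gamma>)) s a \<le> B / (1 - \<gamma>)" by (simp add: G_const)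
    qed
    show "0 \<le> B / (1 - \<gamma>)" using \<open>0 \<le> B\<close> \<gamma> by simp
  qed
  have "\<exists>a. v s = G v s a" for s
  proof -
    have "F v s \<in> range (G v s)" unfolding F_def by (rule Max_in) auto
    with v show ?thesis by auto
  qed
  \<comment> \<open>The maximum over the finite action set is attained, which makes the greedy
    policy deterministic.\<close>
  then obtain d where d: "\<And>s. v s = G v s (d s)" by metis
  define \<pi> :: "('s, 'a) policy" where "\<pi> = (\<lambda>h s. return_pmf (d s))"

  \<comment> \<open>The two saddle-point inequalities\<close>
  have kern_sum: "(\<Sum>s'\<in>UNIV. kern w s a $ s' * v s') = (\<Sum>i=1..r. u i s a * (\<Sum>s'\<in>UNIV. w i $ s' * v s'))"
    for w s a
    unfolding kern_def by (simp add: sum_component sum_distrib_right sum_distrib_left mult.assoc) (rule sum.swap)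
  let ?val = "\<Sum>s\<in>UNIV. pmf p0 s * v s"
  \<comment> \<open>Against the minimising kernel the one-step value of every action
    \<open>a\<close> is exactly \<open>G v s a\<close>, which is at most
    \<open>F v s = v s\<close>.\<close>
  have upper: "reward p0 rew \<gamma> \<pi>' (kern (wmin v)) \<le> ?val" for \<pi>'
  proof (rule reward_le_supersolution[OF \<gamma>])
    show "prob_vector (kern (wmin v) s a)" for s a using wmin by (intro kern_prob) auto
    show "rew s a + \<gamma> * (\<Sum>s'\<in>UNIV. kern (wmin v) s a $ s' * v s') \<le> v s" for s a
      using G_le[of v s a] unfolding v by (simp add: kern_sum G_def wmin)
  qed
  \<comment> \<open>On the support of the greedy policy \<open>v s = G v s a\<close>, and each
    \<open>m i v\<close> is at most the expectation under any other factor in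
    \<open>\<W> i\<close>.\<close>
  have lower: "?val \<le> reward p0 rew \<gamma> \<pi> (kern w)" if "w \<in> Z" for w
  proof (rule reward_ge_subsolution[OF \<gamma>])
    show "prob_vector (kern w s a)" for s a using Z that by (intro kern_prob) auto
    fix h s a assume "a \<in> set_pmf (\<pi> h s)"
    then have "v s = G v s a" using d by (simp add: \<pi>_def)
    also have "\<dots> \<le> rew s a + \<gamma> * (\<Sum>s'\<in>UNIV. kern w s a $ s' * v s')"
      unfolding G_def kern_sum using \<gamma> u_nonneg m_le Z[OF that]
      by (intro add_left_mono mult_left_mono sum_mono) auto
    finally show "v s \<le> rew s a + \<gamma> * (\<Sum>s'\<in>UNIV. kern w s a $ s' * v s')" .
  qed
  have "kern (wmin v) \<in> kern ` Z"
    using wmin(1) unfolding rect[symmetric] by (auto simp: r_rectangular_def kern_def)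
  \<comment> \<open>A real infimum bounds its members from below only for sets bounded below; the
    attained minimum supplies the bound.\<close>
  moreover have "bdd_below ((\<lambda>P. reward p0 rew \<gamma> \<pi>' P) ` (kern ` Z))" for \<pi>'
    using attained[of \<pi>'] by (meson bdd_below.I2)
  ultimately have "(INF P\<in>kern ` Z. reward p0 rew \<gamma> \<pi>' P) \<le> reward p0 rew \<gamma> \<pi>' (kern (wmin v))" for \<pi>'
    by (intro cINF_lower)
  \<comment> \<open>Both sides are compared with \<open>?val\<close>, the value of the game.\<close>
  also have "reward p0 rew \<gamma> \<pi>' (kern (wmin v)) \<le> (INF P\<in>kern ` Z. reward p0 rew \<gamma> \<pi> P)" for \<pi>'
    using upper[of \<pi>'] lower Z_ne by (intro cINF_greatest) (auto intro: order_trans)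
  finally have "solves_policy_improvement p0 rew \<gamma> (r_rectangular r u \<W>) \<pi>"
    unfolding solves_policy_improvement_def rect using attained by blast
  moreover have "stationary \<pi>" "deterministic \<pi>"
    by (auto simp: stationary_def deterministic_def \<pi>_def indicator_def)
  ultimately show ?thesis by blast
qed

end
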